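(* Let $U\subseteq\mathbb{M}\mathbb{C}(n)$ be open. A function $F:U\to\mathbb{M}\mathbb{C}(n)$ of class $C^1$ is multicomplex holomorphic if and only if it is $\mathbf{i}_k$-holomorphic for each of the generators $\mathbf{i}_1,\dots,\mathbf{i}_n$. Equivalently, $$\mathrm{Hol}(U)=\bigcap_{k=1}^n\mathrm{Hol}_{\mathbf{i}_k}(U).$$
   Context: Let $n\ge1$. The multicomplex numbers are defined recursively by $\mathbb{M}\mathbb{C}(0)=\mathbb{R}$ and $\mathbb{M}\mathbb{C}(n)=\{\eta_1+\eta_2\mathbf{i}_n:\eta_1,\eta_2\in\mathbb{M}\mathbb{C}(n-1)\}$ with $\mathbf{i}_n^2=-1$, where $\mathbf{i}_n$ is a new formal square root of $-1$ commuting with everything. Thus $\mathbb{M}\mathbb{C}(n)$ is a commutative unital real algebra of dimension $2^n$ generated by commuting units $\mathbf{i}_1,\dots,\mathbf{i}_n$ with $\mathbf{i}_k^2=-1$; the $2^n$ monomials $\mathbf{i}_1^{a_1}\cdots\mathbf{i}_n^{a_n}$, $a_k\in\{0,1\}$, form a real basis. "Class $C^1$" means continuously differentiable as a map between real vector spaces, and $DF(\eta)$ is the real differential at $\eta$. $F$ is multicomplex holomorphic on $U$ ($F\in\mathrm{Hol}(U)$) if it is $C^1$ and for every $\eta\in U$ there is $\lambda(\eta)\in\mathbb{M}\mathbb{C}(n)$ with $DF(\eta)[h]=\lambda(\eta)h$ for all $h\in\mathbb{M}\mathbb{C}(n)$. $F$ is $\mathbf{i}_k$-holomorphic on $U$ ($F\in\mathrm{Hol}_{\mathbf{i}_k}(U)$)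 if it is $C^1$ and $DF(\eta)\circ\mathcal{L}_{\mathbf{i}_k}=\mathcal{L}_{\mathbf{i}_k}\circ DF(\eta)$ for every $\eta\in U$, where $\mathcal{L}_{\mathbf{i}_k}(h)=\mathbf{i}_kh$. *)

theory Defs
  imports "HOL-Analysis.Analysis"
begin

section \<open>Multicomplex numbers\<close>

text \<open>
  The finite index type \<open>'n\<close> plays the role of \<open>{1, \<dots>, n}\<close>, so that \<open>n = CARD('n) \<ge> 1\<close>.
  An element of \<open>'n multicomplex\<close> is given by its \<open>2 ^ n\<close> real coordinates with respect to the
  monomials \<open>\<Prod>k\<in>A. imag_unit k\<close>, where \<open>A\<close> ranges over the sets of indices.  That these are
  the multicomplex numbers in the recursive sense is shown by the lemmas \<open>mc_step_bij\<close>,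
  \<open>mc_step_decomp\<close>, \<open>mc_step_mult\<close> below (from \<open>n\<close> to \<open>n + 1\<close>, where the new unit is indexed by
  \<open>None\<close>) and \<open>mc_one_unit\<close> (\<open>n = 1\<close>).
\<close>

typedef 'n multicomplex = "UNIV :: ('n set \<Rightarrow> real) set"
  morphisms mc_coeff mc_of_coeffs
  by simp

lemma mc_coeff_of_coeffs [simp]: "mc_coeff (mc_of_coeffs f) = f"
  by (simp add: mc_of_coeffs_inverse)

lemma mc_eqI: "(\<And>A. mc_coeff x A = mc_coeff y A) \<Longrightarrow> x = y"
  by (metis ext mc_coeff_inject)

lemma mc_eq_iff: "x = y \<longleftrightarrow> (\<forall>A. mc_coeff x A = mc_coeff y A)"
  by (auto intro: mc_eqI)

subsection \<open>Euclidean space structure\<close>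

instantiation multicomplex :: (type) real_vector
begin
definition "0 = mc_of_coeffs (\<lambda>A. 0)"
definition "x + y = mc_of_coeffs (\<lambda>A. mc_coeff x A + mc_coeff y A)"
definition "x - y = mc_of_coeffs (\<lambda>A. mc_coeff x A - mc_coeff y A)"
definition "- x = mc_of_coeffs (\<lambda>A. - mc_coeff x A)"
definition "c *\<^sub>R x = mc_of_coeffs (\<lambda>A. c * mc_coeff x A)"
instance
  by standard
    (simp_all add: mc_eq_iff zero_multicomplex_def plus_multicomplex_def minus_multicomplex_def
      uminus_multicomplex_def scaleR_multicomplex_def algebra_simps)
end

lemma mc_coeff_linear [simp]:
  "mc_coeff 0 A = 0"
  "mc_coeff (x + y) A = mc_coeff x A + mc_coeff y A"
  "mc_coeff (x - y) A = mc_coeff x A - mc_coeff y A"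
  "mc_coeff (- x) A = - mc_coeff x A"
  "mc_coeff (c *\<^sub>R x) A = c * mc_coeff x A"
  by (simp_all add: zero_multicomplex_def plus_multicomplex_def minus_multicomplex_def
      uminus_multicomplex_def scaleR_multicomplex_def)

definition mc_basis :: "'n set \<Rightarrow> 'n multicomplex" where
  "mc_basis A = mc_of_coeffs (\<lambda>B. if B = A then 1 else 0)"

lemma mc_coeff_basis [simp]: "mc_coeff (mc_basis A) B = (if B = A then 1 else 0)"
  by (simp add: mc_basis_def)

lemma mc_basis_inject [simp]: "mc_basis A = mc_basis B \<longleftrightarrow> A = B"
  by (metis mc_coeff_basis zero_neq_one)

instantiation multicomplex :: (finite) euclidean_space
begin
definition "inner x y = (\<Sum>A\<in>UNIV. mc_coeff x A * mc_coeff y A)"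
definition "norm x = sqrt (inner x (x :: 'a multicomplex))"
definition "sgn x = x /\<^sub>R norm (x :: 'a multicomplex)"
definition "dist x y = norm (x - y :: 'a multicomplex)"
definition [code del]: "(uniformity :: ('a multicomplex \<times> 'a multicomplex) filter) =
  (INF e\<in>{0 <..}. principal {(x, y). dist x y < e})"
definition [code del]: "open (U :: 'a multicomplex set) \<longleftrightarrow>
  (\<forall>x\<in>U. \<forall>\<^sub>F (x', y) in uniformity. x' = x \<longrightarrow> y \<in> U)"
definition "Basis = range (mc_basis :: 'a set \<Rightarrow> 'a multicomplex)"
instance
proof
  fix x y z :: "'a multicomplex" and r :: real and U :: "'a multicomplex set"
  have inner_basis: "inner x (mc_basis A) = mc_coeff x A" for x :: "'a multicomplex" and A
    by (simp add: inner_multicomplex_def if_distrib[of "(*) _"] cong: if_cong)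
  show "inner x y = inner y x"
    by (simp add: inner_multicomplex_def mult.commute)
  show "inner (x + y) z = inner x z + inner y z"
    by (simp add: inner_multicomplex_def distrib_right sum.distrib)
  show "inner (r *\<^sub>R x) y = r * inner x y"
    by (simp add: inner_multicomplex_def sum_distrib_left mult.assoc)
  show "0 \<le> inner x x"
    by (simp add: inner_multicomplex_def sum_nonneg)
  show "inner x x = 0 \<longleftrightarrow> x = 0"
    by (simp add: inner_multicomplex_def sum_nonneg_eq_0_iff mc_eq_iff)
  show "(Basis :: 'a multicomplex set) \<noteq> {}" "finite (Basis :: 'a multicomplex set)"
    by (simp_all add: Basis_multicomplex_def)
  show "inner x y = (if x = y then 1 else 0)" if "x \<in> Basis" "y \<in> Basis"
    using that by (auto simp: Basis_multicomplex_def inner_basis)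
  show "(\<forall>u\<in>Basis. inner x u = 0) \<longleftrightarrow> x = 0"
    by (auto simp: Basis_multicomplex_def inner_basis mc_eq_iff)
qed (simp_all add: norm_multicomplex_def sgn_multicomplex_def dist_multicomplex_def
    uniformity_multicomplex_def open_multicomplex_def)
end

lemma DIM_multicomplex: "DIM('n::finite multicomplex) = 2 ^ CARD('n)"
proof -
  have "inj (mc_basis :: 'n set \<Rightarrow> 'n multicomplex)"
    by (simp add: inj_on_def)
  then have "DIM('n multicomplex) = card (UNIV :: 'n set set)"
    by (simp add: Basis_multicomplex_def card_image)
  then show ?thesis
    by (simp add: card_Pow flip: Pow_UNIV)
qed

subsection \<open>Multiplication\<close>

text \<open>
  Since the units commute and square to \<open>-1\<close>, the monomials of \<open>A\<close> and \<open>B\<close> multiply to the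
  monomial of the symmetric difference of \<open>A\<close> and \<open>B\<close>, with one sign for each common unit.
\<close>

lemma sym_diff_eq_iff: "sym_diff A B = C \<longleftrightarrow> B = sym_diff A C"
  by blast

lemma bij_sym_diff: "bij (\<lambda>A. sym_diff A C)" "bij (sym_diff C)"
  by (rule o_bij[of "\<lambda>A. sym_diff A C"] o_bij[of "sym_diff C"]; (simp add: fun_eq_iff; blast))+

lemma mc_sign_eq_prod:
  "(-1) ^ card (A \<inter> B) = (\<Prod>k\<in>UNIV. if k \<in> A \<and> k \<in> B then -1 else (1::real))"
  for A B :: "'n::finite set"
  by (simp add: prod.If_cases Int_def)

lemma mc_sign_assoc:
  "(-1) ^ card (sym_diff A B \<inter> C) * (-1) ^ card (A \<inter> B)
    = (-1) ^ card (A \<inter> sym_diff B C) * ((-1) ^ card (B \<inter> C) :: real)"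
  for A B C :: "'n::finite set"
  unfolding mc_sign_eq_prod prod.distrib[symmetric]
proof (rule prod.cong[OF refl])
  fix k
  show "(if k \<in> sym_diff A B \<and> k \<in> C then -1 else 1) * (if k \<in> A \<and> k \<in> B then -1 else 1)
    = (if k \<in> A \<and> k \<in> sym_diff B C then -1 else 1) * (if k \<in> B \<and> k \<in> C then -1 else (1::real))"
    by (cases "k \<in> A"; cases "k \<in> B"; cases "k \<in> C") simp_all
qed

instantiation multicomplex :: (finite) "{one, times}"
begin
definition "1 = mc_basis {}"
definition "x * y = mc_of_coeffs (\<lambda>C.
  \<Sum>(A, B) | sym_diff A B = C. (-1) ^ card (A \<inter> B) * mc_coeff x A * mc_coeff y B)"
instance ..
end

lemma mc_coeff_mult:
  "mc_coeff (x * y) C = (\<Sum>A\<in>UNIV.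
    (-1) ^ card (A \<inter> sym_diff A C) * mc_coeff x A * mc_coeff y (sym_diff A C))"
  for x y :: "'n::finite multicomplex"
proof -
  have "{(A, B). sym_diff A B = C} = (\<lambda>A. (A, sym_diff A C)) ` UNIV"
    by blast
  moreover have "inj (\<lambda>A. (A, sym_diff A C))"
    by (simp add: inj_on_def)
  ultimately show ?thesis
    by (simp add: times_multicomplex_def sum.reindex)
qed

instance multicomplex :: (finite) semigroup_mult
proof
  fix x y z :: "'a multicomplex"
  have inv: "sym_diff A (sym_diff A C) = C" for A C :: "'a set"
    by blast
  have rearrange: "p * (q * a * b) * c = r * a * (t * b * c)" if "p * q = r * t"
    for p q r t a b c :: real
    using arg_cong[OF that, of "\<lambda>u. u * (a * b * c)"] by (simp add: mult_ac)
  show "x * y * z = x * (y * z)"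
  proof (rule mc_eqI)
    fix D :: "'a set"
    let ?s = "\<lambda>A B :: 'a set. (-1) ^ card (A \<inter> B) :: real"
    let ?t = "\<lambda>A B. ?s A B * mc_coeff x A * mc_coeff y B"
    have "mc_coeff (x * y * z) D = (\<Sum>A\<in>UNIV. \<Sum>E\<in>UNIV.
        ?s E (sym_diff E D) * ?t A (sym_diff A E) * mc_coeff z (sym_diff E D))"
      unfolding mc_coeff_mult sum_distrib_left sum_distrib_right by (rule sum.swap)
    also have "\<dots> = (\<Sum>A\<in>UNIV. \<Sum>B\<in>UNIV.
        ?s (sym_diff A B) (sym_diff (sym_diff A B) D) * ?t A B
          * mc_coeff z (sym_diff (sym_diff A B) D))"
    proof (rule sum.cong[OF refl])
      fix A :: "'a set"
      show "(\<Sum>E\<in>UNIV. ?s E (sym_diff E D) * ?t A (sym_diff A E) * mc_coeff z (sym_diff E D))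
        = (\<Sum>B\<in>UNIV. ?s (sym_diff A B) (sym_diff (sym_diff A B) D) * ?t A B
          * mc_coeff z (sym_diff (sym_diff A B) D))"
        by (subst sum.reindex_bij_betw[OF bij_sym_diff(2)[of A], symmetric]) (simp only: inv)
    qed
    also have "\<dots> = (\<Sum>A\<in>UNIV. \<Sum>B\<in>UNIV. ?s A (sym_diff A D) * mc_coeff x A
        * (?s B (sym_diff B (sym_diff A D)) * mc_coeff y B
          * mc_coeff z (sym_diff B (sym_diff A D))))"
    proof (intro sum.cong refl)
      fix A B :: "'a set"
      have *: "sym_diff (sym_diff A B) D = sym_diff B (sym_diff A D)"
        by blast
      show "?s (sym_diff A B) (sym_diff (sym_diff A B) D) * ?t A B
          * mc_coeff z (sym_diff (sym_diff A B) D)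
        = ?s A (sym_diff A D) * mc_coeff x A * (?s B (sym_diff B (sym_diff A D)) * mc_coeff y B
          * mc_coeff z (sym_diff B (sym_diff A D)))"
        using mc_sign_assoc[of A B "sym_diff B (sym_diff A D)"]
        unfolding * inv by (rule rearrange)
    qed
    also have "\<dots> = mc_coeff (x * (y * z)) D"
      unfolding mc_coeff_mult sum_distrib_left ..
    finally show "mc_coeff (x * y * z) D = mc_coeff (x * (y * z)) D" .
  qed
qed

instance multicomplex :: (finite) ab_semigroup_mult
proof
  fix x y :: "'a multicomplex"
  show "x * y = y * x"
  proof (rule mc_eqI)
    fix C :: "'a set"
    have *: "sym_diff (sym_diff A C) C = A" for A :: "'a set"
      by blast
    show "mc_coeff (x * y) C = mc_coeff (y * x) C"
      unfolding mc_coeff_mult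
      by (subst sum.reindex_bij_betw[OF bij_sym_diff(1)[of C], symmetric])
        (simp only: * Int_commute mult.commute mult.left_commute mult.assoc)
  qed
qed

instance multicomplex :: (finite) comm_monoid_mult
proof
  fix x :: "'a multicomplex"
  show "1 * x = x"
  proof (rule mc_eqI)
    fix C
    have "mc_coeff (1 * x) C = (\<Sum>A\<in>(UNIV :: 'a set set). if A = {} then mc_coeff x C else 0)"
      unfolding mc_coeff_mult one_multicomplex_def mc_coeff_basis by (intro sum.cong) auto
    then show "mc_coeff (1 * x) C = mc_coeff x C"
      by simp
  qed
qed

instance multicomplex :: (finite) comm_ring
proof
  fix x y z :: "'a multicomplex"
  show "(x + y) * z = x * z + y * z"
    by (rule mc_eqI) (simp only: mc_coeff_mult mc_coeff_linear ring_distribs sum.distrib)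
qed

instance multicomplex :: (finite) comm_ring_1
proof
  show "(0 :: 'a multicomplex) \<noteq> 1"
  proof
    assume "(0 :: 'a multicomplex) = 1"
    then have "mc_coeff (0 :: 'a multicomplex) {} = mc_coeff (mc_basis {} :: 'a multicomplex) {}"
      unfolding one_multicomplex_def by (rule arg_cong)
    then show False
      unfolding mc_coeff_basis mc_coeff_linear by simp
  qed
qed

instance multicomplex :: (finite) real_algebra_1
proof
  fix a :: real and x y :: "'a multicomplex"
  show "a *\<^sub>R x * y = a *\<^sub>R (x * y)" "x * a *\<^sub>R y = a *\<^sub>R (x * y)"
    by (rule mc_eqI, simp add: mc_coeff_mult sum_distrib_left mult.assoc mult.left_commute)+
qed

definition imag_unit :: "'n \<Rightarrow> 'n multicomplex" where
  "imag_unit k = mc_basis {k}"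

lemma mc_basis_mult:
  "mc_basis A * mc_basis B = (-1) ^ card (A \<inter> B) *\<^sub>R mc_basis (sym_diff A B)"
  for A B :: "'n::finite set"
proof (rule mc_eqI)
  fix C
  have "mc_coeff (mc_basis A * mc_basis B) C
    = (\<Sum>D\<in>UNIV. if D = A then (-1) ^ card (D \<inter> sym_diff D C) * (if sym_diff D C = B then 1 else 0) else 0)"
    unfolding mc_coeff_mult mc_coeff_basis by (intro sum.cong) auto
  also have "\<dots> = (-1) ^ card (A \<inter> sym_diff A C) * (if sym_diff A C = B then 1 else 0)"
    by simp
  also have "\<dots> = mc_coeff ((-1) ^ card (A \<inter> B) *\<^sub>R mc_basis (sym_diff A B)) C"
  proof (cases "B = sym_diff A C")
    case True
    then have "C = sym_diff A B"
      by blast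
    with True show ?thesis
      by simp
  next
    case False
    then have "C \<noteq> sym_diff A B"
      by blast
    with False show ?thesis
      by auto
  qed
  finally show "mc_coeff (mc_basis A * mc_basis B) C
    = mc_coeff ((-1) ^ card (A \<inter> B) *\<^sub>R mc_basis (sym_diff A B)) C" .
qed

lemma imag_unit_square: "imag_unit k * imag_unit k = - 1" for k :: "'n::finite"
  by (simp add: imag_unit_def mc_basis_mult one_multicomplex_def)

lemma mc_basis_eq_prod: "mc_basis A = (\<Prod>k\<in>A. imag_unit k)" for A :: "'n::finite set"
proof (induction A rule: finite_induct[OF finite])
  case 1
  show ?case by (simp add: one_multicomplex_def)
next
  case (2 k A)
  then have *: "sym_diff {k} A = insert k A" "{k} \<inter> A = {}"
    by auto
  have "(\<Prod>j\<in>insert k A. imag_unit j) = imag_unit k * mc_basis A"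
    using 2 by simp
  also have "\<dots> = mc_basis (insert k A)"
    unfolding imag_unit_def mc_basis_mult * by simp
  finally show ?case ..
qed

lemma Basis_multicomplex: "Basis = range (\<lambda>A. \<Prod>k\<in>A. imag_unit (k::'n::finite))"
  by (simp add: Basis_multicomplex_def mc_basis_eq_prod)

subsection \<open>The recursion\<close>

text \<open>
  \<open>mc_step \<eta>\<^sub>1 \<eta>\<^sub>2\<close> is \<open>\<eta>\<^sub>1 + \<eta>\<^sub>2 * imag_unit None\<close>, with \<open>\<eta>\<^sub>1\<close> and \<open>\<eta>\<^sub>2\<close> on the right read
  in \<open>'n option multicomplex\<close>.
\<close>

definition mc_step :: "'n multicomplex \<Rightarrow> 'n multicomplex \<Rightarrow> 'n option multicomplex" where
  "mc_step a b = mc_of_coeffs (\<lambda>A. mc_coeff (if None \<in> A then b else a) (Some -` A))"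

lemma mc_step_coeff [simp]:
  "mc_coeff (mc_step a b) (Some ` A) = mc_coeff a A"
  "mc_coeff (mc_step a b) (insert None (Some ` A)) = mc_coeff b A"
  by (auto simp: mc_step_def vimage_def intro!: arg_cong2[of _ _ _ _ mc_coeff])

lemma option_set_cases:
  obtains B where "A = Some ` B" | B where "A = insert None (Some ` B)"
proof -
  have *: "A - {None} = Some ` (Some -` A)"
    unfolding image_vimage_eq by (auto simp flip: notin_range_Some)
  show ?thesis
  proof (cases "None \<in> A")
    case True
    with * that(2) show ?thesis by (metis insert_Diff)
  next
    case False
    with * that(1) show ?thesis by (metis Diff_empty Diff_insert0)
  qed
qed

lemma mc_option_eqI:
  assumes "\<And>A. mc_coeff x (Some ` A) = mc_coeff y (Some ` A)"
    and "\<And>A. mc_coeff x (insert None (Some ` A)) = mc_coeff y (insert None (Some ` A))"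
  shows "x = y"
  by (rule mc_eqI) (metis assms option_set_cases)

lemma mc_step_bij: "bij (\<lambda>(a, b). mc_step a b)"
proof (rule o_bij)
  show "(\<lambda>(a, b). mc_step a b) \<circ> (\<lambda>x. (mc_of_coeffs (\<lambda>A. mc_coeff x (Some ` A)),
      mc_of_coeffs (\<lambda>A. mc_coeff x (insert None (Some ` A))))) = id"
    by (auto simp: fun_eq_iff intro!: mc_option_eqI)
qed (auto simp: fun_eq_iff mc_eq_iff)

lemma mc_step_linear:
  "mc_step (a + c) (b + d) = mc_step a b + mc_step c d"
  "mc_step (r *\<^sub>R a) (r *\<^sub>R b) = r *\<^sub>R mc_step a b"
  by (rule mc_option_eqI; simp)+

lemma mc_step_one: "mc_step 1 0 = (1 :: 'n::finite option multicomplex)"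
  by (rule mc_option_eqI) (simp_all add: one_multicomplex_def)

lemma sum_option_sets:
  "(\<Sum>A\<in>UNIV. f A) = (\<Sum>A\<in>UNIV. f (Some ` A)) + (\<Sum>A\<in>UNIV. f (insert None (Some ` A)))"
  for f :: "'n::finite option set \<Rightarrow> real"
proof -
  have U: "UNIV = range (image Some) \<union> range (\<lambda>A :: 'n set. insert None (Some ` A))"
    by (auto intro: option_set_cases)
  have "inj (image Some :: 'n set \<Rightarrow> _)" "inj (\<lambda>A :: 'n set. insert None (Some ` A))"
    by (auto simp: inj_on_def)
  moreover have "range (image Some) \<inter> range (\<lambda>A :: 'n set. insert None (Some ` A)) = {}"
    by auto
  ultimately show ?thesis
    by (subst U, subst sum.union_disjoint) (simp_all add: sum.reindex)
qed

lemma mc_step_mult: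
  "mc_step a b * mc_step c d = mc_step (a * c - b * d) (a * d + b * c)"
  for a b c d :: "'n::finite multicomplex"
proof -
  let ?S = "image Some :: 'n set \<Rightarrow> 'n option set"
  have sd: "sym_diff (?S A) (?S B) = ?S (sym_diff A B)"
    "sym_diff (?S A) (insert None (?S B)) = insert None (?S (sym_diff A B))"
    "sym_diff (insert None (?S A)) (?S B) = insert None (?S (sym_diff A B))"
    "sym_diff (insert None (?S A)) (insert None (?S B)) = ?S (sym_diff A B)" for A B
    by auto
  have int: "?S A \<inter> ?S B = ?S (A \<inter> B)" "?S A \<inter> insert None (?S B) = ?S (A \<inter> B)"
    "insert None (?S A) \<inter> ?S B = ?S (A \<inter> B)"
    "insert None (?S A) \<inter> insert None (?S B) = insert None (?S (A \<inter> B))" for A B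
    by auto
  have card: "card (?S A) = card A" "card (insert None (?S A)) = Suc (card A)" for A
    by (simp_all add: card_image)
  show ?thesis
    by (rule mc_option_eqI)
      (simp_all only: mc_coeff_mult sum_option_sets sd int card mc_step_coeff mc_coeff_linear
        power_Suc mult_minus_left mult_1 sum_negf diff_conv_add_uminus)
qed

lemma mc_step_imag_unit:
  "mc_step (imag_unit k) 0 = imag_unit (Some k)" "mc_step 0 1 = imag_unit None" for k :: "'n::finite"
  by (rule mc_option_eqI; auto simp: imag_unit_def one_multicomplex_def)+

lemma mc_step_decomp: "mc_step a b = mc_step a 0 + mc_step b 0 * imag_unit None"
  for a b :: "'n::finite multicomplex"
  by (simp add: mc_step_mult flip: mc_step_imag_unit mc_step_linear)

lemma mc_one_unit:
  fixes z :: "'n::finite multicomplex"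
  assumes "CARD('n) = 1"
  shows "\<exists>!(a, b). z = of_real a + of_real b * imag_unit k"
proof -
  have U: "UNIV = {k}"
    using assms by (metis UNIV_I card_1_singletonE singletonD)
  have "A = {} \<or> A = {k}" for A
    using U by (metis subset_UNIV subset_singletonD)
  then have all: "(\<forall>A. P A) \<longleftrightarrow> P {} \<and> P {k}" for P
    by metis
  have *: "z = of_real a + of_real b * imag_unit k \<longleftrightarrow> mc_coeff z {} = a \<and> mc_coeff z {k} = b" for a b
    unfolding mc_eq_iff all of_real_def
    by (simp add: imag_unit_def one_multicomplex_def mc_basis_mult)
  show ?thesis
    unfolding * by auto
qed

section \<open>Holomorphy\<close>

text \<open>
  Functions defined on an open set \<open>U\<close> are represented by total functions, whose values outside
  \<open>U\<close> are irrelevant.  In particular, the sets \<open>Hol U\<close> and \<open>Hol_unit k U\<close> consist of total functions.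
\<close>

definition C1_on :: "('a::real_normed_vector \<Rightarrow> 'b::real_normed_vector) \<Rightarrow> 'a set \<Rightarrow> bool" where
  "C1_on F U \<longleftrightarrow> (\<exists>F' :: 'a \<Rightarrow> 'a \<Rightarrow>\<^sub>L 'b.
    (\<forall>\<eta>\<in>U. (F has_derivative blinfun_apply (F' \<eta>)) (at \<eta>)) \<and> continuous_on U F')"

definition Hol :: "'n::finite multicomplex set \<Rightarrow> ('n multicomplex \<Rightarrow> 'n multicomplex) set" where
  "Hol U = {F. C1_on F U \<and> (\<forall>\<eta>\<in>U. \<exists>l. \<forall>h. frechet_derivative F (at \<eta>) h = l * h)}"

definition Hol_unit ::
  "'n::finite \<Rightarrow> 'n multicomplex set \<Rightarrow> ('n multicomplex \<Rightarrow> 'n multicomplex) set" where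
  "Hol_unit k U = {F. C1_on F U \<and> (\<forall>\<eta>\<in>U.
    frechet_derivative F (at \<eta>) \<circ> (\<lambda>h. imag_unit k * h) = (\<lambda>h. imag_unit k * h) \<circ> frechet_derivative F (at \<eta>))}"

end

theory Submission
  imports Defs
begin

text \<open>
  At a fixed point only the linear algebra of the differential matters.  If a real linear map \<open>L\<close>
  commutes with multiplication by each generator, it commutes with multiplication by each product
  of generators, so that \<open>L b = b * L 1\<close> for each such product \<open>b\<close>.  These products form the
  standard basis, hence \<open>L h = L 1 * h\<close> for all \<open>h\<close>.  Conversely, multiplication by a fixed number
  commutes with every other multiplication, because the algebra is commutative and associative.
\<close>

lemma commutes_with_prod_mult:
  fixes L :: "'a::comm_monoid_mult \<Rightarrow> 'a"
  assumes "\<And>k h. k \<in> A \<Longrightarrow> L (f k * h) = f k * L h"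
  shows "L ((\<Prod>k\<in>A. f k) * h) = (\<Prod>k\<in>A. f k) * L h"
  using assms by (induction A rule: infinite_finite_induct) (simp_all add: mult.assoc)

lemma linear_eq_mult_iff_commutes_imag_units:
  fixes L :: "'n::finite multicomplex \<Rightarrow> 'n multicomplex"
  assumes "linear L"
  shows "(\<exists>l. \<forall>h. L h = l * h) \<longleftrightarrow> (\<forall>k h. L (imag_unit k * h) = imag_unit k * L h)"
proof
  assume "\<exists>l. \<forall>h. L h = l * h"
  then show "\<forall>k h. L (imag_unit k * h) = imag_unit k * L h"
    by (auto simp: mult.left_commute)
next
  assume commutes: "\<forall>k h. L (imag_unit k * h) = imag_unit k * L h"
  have "L = (\<lambda>h. L 1 * h)"
  proof (rule linear_eq_stdbasis)
    show "linear (\<lambda>h. L 1 * h)"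
      by (intro linearI) (simp_all add: distrib_left)
    fix b :: "'n multicomplex"
    assume "b \<in> Basis"
    then obtain A where "b = (\<Prod>k\<in>A. imag_unit k)"
      unfolding Basis_multicomplex by blast
    then show "L b = L 1 * b"
      using commutes_with_prod_mult[of A L imag_unit 1] commutes by (simp add: mult.commute)
  qed (rule assms)
  then show "\<exists>l. \<forall>h. L h = l * h"
    by metis
qed

lemma C1_on_linear_frechet_derivative:
  assumes "C1_on F U" and "\<eta> \<in> U"
  shows "linear (frechet_derivative F (at \<eta>))"
  using assms unfolding C1_on_def by (blast intro: linear_frechet_derivative differentiableI)

theorem corollary4p8:
  fixes U :: "'n::finite multicomplex set"
  assumes "open U"
  shows "(\<forall>F. C1_on F U \<longrightarrow> (F \<in> Hol U \<longleftrightarrow> (\<forall>k. F \<in> Hol_unit k U)))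
    \<and> Hol U = (\<Inter>k. Hol_unit k U)"
proof -
  have "F \<in> Hol U \<longleftrightarrow> (\<forall>k. F \<in> Hol_unit k U)" if "C1_on F U" for F
  proof -
    have "(\<exists>l. \<forall>h. frechet_derivative F (at \<eta>) h = l * h) \<longleftrightarrow>
      (\<forall>k h. frechet_derivative F (at \<eta>) (imag_unit k * h)
        = imag_unit k * frechet_derivative F (at \<eta>) h)" if "\<eta> \<in> U" for \<eta>
      using C1_on_linear_frechet_derivative[OF \<open>C1_on F U\<close> that]
      by (rule linear_eq_mult_iff_commutes_imag_units)
    with that show ?thesis
      unfolding Hol_def Hol_unit_def by (auto simp: fun_eq_iff)
  qed
  moreover have "C1_on F U" if "F \<in> Hol U \<or> (\<forall>k. F \<in> Hol_unit k U)" for F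
    using that by (auto simp: Hol_def Hol_unit_def)
  ultimately show ?thesis
    by blast
qed

end
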